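(* Let $\mathsf P,\mathsf H$ be Polish spaces, let $\ell:\mathbb R^n\times\mathsf P\to[0,+\infty]$ and $\mathcal A:\mathsf H\times\mathbb R^n\times\mathsf P\to\mathbb R^n$ be measurable, and fix $x^{(0)}\in\mathbb R^n$. Let $P,P_1,\dots,P_N$ be i.i.d. $\mathsf P$-valued random variables, put $D=(P_1,\dots,P_N)$, and let $H$ be an $\mathsf H$-valued random variable independent of $D$ and of $P$. Assume that there is a measurable function $\rho:\mathsf H\to[0,\infty)$ such that for every $h\in\mathsf H$ $$\ell(\mathcal A(h,x^{(0)},p),p)\le\rho(h)\,\ell(x^{(0)},p)\qquad\text{for }\mathbb P_P\text{-almost every }p,$$ and that $\mathbb E[\ell(x^{(0)},P)^2]<\infty$. Define, for $\gamma>0$, $h\in\mathsf H$, $d\in\mathsf P^N$, $$\eta(\gamma):=\left(\gamma,\ -\frac{\gamma^2}2\right),\qquad T(h,d):=\left(\mathcal R(h)-\hat{\mathcal R}(h,d),\ \frac{\rho(h)^2}{N}\,\mathbb E\left[\ell(x^{(0)},P)^2\right]\right),$$ and $c(\gamma,d):=\int_{\mathsf H}\exp(\langle\eta(\gamma),T(h,d)\rangle)\,\mathbb P_H(dh)$. Then $\mathbb E[c(\gamma,D)]\le1$ for all $\gamma>0$.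
   Context: Spaces carry their Borel $\sigma$-algebras and products carry product $\sigma$-algebras. All random variables live on one probability space $(\Omega,\mathcal F,\mathbb P)$; $\mathbb P_X$ is the law of $X$. Write $\ell(h,p):=\ell(\mathcal A(h,x^{(0)},p),p)$ for $h\in\mathsf H$, $p\in\mathsf P$. The risk is $\mathcal R(h):=\mathbb E[\ell(h,P)]$ and the empirical risk is $\hat{\mathcal R}(h,d):=\frac1N\sum_{i=1}^N\ell(h,p_i)$ for $d=(p_1,\dots,p_N)\in\mathsf P^N$. *)

theory Defs
  imports "HOL-Probability.Probability"
begin

text \<open>
  The library constant \<open>indep_var\<close> requires both variables to have the same value type. This is the
  same notion (independence of the generated sigma-algebras) for values in different types.
\<close>

definition indep_rv ::
  "'w measure \<Rightarrow> 'a measure \<Rightarrow> ('w \<Rightarrow> 'a) \<Rightarrow> 'b measure \<Rightarrow> ('w \<Rightarrow> 'b) \<Rightarrow> bool" where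
  "indep_rv M MX X MY Y \<longleftrightarrow>
     X \<in> measurable M MX \<and> Y \<in> measurable M MY \<and>
     prob_space.indep_set M {X -` A \<inter> space M |A. A \<in> sets MX} {Y -` B \<inter> space M |B. B \<in> sets MY}"

definition iid_vars :: "'w measure \<Rightarrow> 'a measure \<Rightarrow> ('i \<Rightarrow> 'w \<Rightarrow> 'a) \<Rightarrow> 'i set \<Rightarrow> bool" where
  "iid_vars M S X I \<longleftrightarrow>
     prob_space.indep_vars M (\<lambda>_. S) X I \<and> (\<forall>i\<in>I. \<forall>j\<in>I. distr M S (X i) = distr M S (X j))"

text \<open>A data set \<open>d = (p\<^sub>1, \<dots>, p\<^sub>N)\<close> is a point of the product space over the index set \<open>{1..N}\<close>.\<close>

abbreviation data_space :: "nat \<Rightarrow> (nat \<Rightarrow> 'p::topological_space) measure" where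
  "data_space N \<equiv> PiM {1..N} (\<lambda>_. borel)"

definition data_var :: "nat \<Rightarrow> (nat \<Rightarrow> 'w \<Rightarrow> 'p) \<Rightarrow> 'w \<Rightarrow> (nat \<Rightarrow> 'p)" where
  "data_var N Ps \<omega> = (\<lambda>i\<in>{1..N}. Ps i \<omega>)"

definition alg_loss ::
  "('x \<Rightarrow> 'p \<Rightarrow> ennreal) \<Rightarrow> ('h \<Rightarrow> 'x \<Rightarrow> 'p \<Rightarrow> 'x) \<Rightarrow> 'x \<Rightarrow> 'h \<Rightarrow> 'p \<Rightarrow> ennreal" where
  "alg_loss l A x0 h p = l (A h x0 p) p"

text \<open>In \<open>risk\<close> and \<open>emp_risk\<close>, \<open>L h p\<close> is the loss of the hyperparameter \<open>h\<close> on the problem \<open>p\<close>.\<close>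

definition risk :: "'w measure \<Rightarrow> ('w \<Rightarrow> 'p) \<Rightarrow> ('h \<Rightarrow> 'p \<Rightarrow> ennreal) \<Rightarrow> 'h \<Rightarrow> ennreal" where
  "risk M P L h = (\<integral>\<^sup>+\<omega>. L h (P \<omega>) \<partial>M)"

definition emp_risk :: "nat \<Rightarrow> ('h \<Rightarrow> 'p \<Rightarrow> ennreal) \<Rightarrow> 'h \<Rightarrow> (nat \<Rightarrow> 'p) \<Rightarrow> ennreal" where
  "emp_risk N L h d = ennreal (1 / real N) * (\<Sum>i=1..N. L h (d i))"

definition eta :: "real \<Rightarrow> real \<times> real" where
  "eta \<gamma> = (\<gamma>, - (\<gamma>\<^sup>2 / 2))"

text \<open>
  Since the loss may be infinite, so may the empirical risk; the statistic and its exponential are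
  therefore extended-real valued, with the usual convention \<open>exp (-\<infinity>) = 0\<close>. The risk is finite
  under the assumptions of the theorem, so \<open>\<infinity> - \<infinity>\<close> does not occur.
\<close>

definition T_stat ::
  "'w measure \<Rightarrow> ('w \<Rightarrow> 'p) \<Rightarrow> nat \<Rightarrow> ('x \<Rightarrow> 'p \<Rightarrow> ennreal) \<Rightarrow> ('h \<Rightarrow> 'x \<Rightarrow> 'p \<Rightarrow> 'x) \<Rightarrow> 'x \<Rightarrow>
   ('h \<Rightarrow> real) \<Rightarrow> 'h \<Rightarrow> (nat \<Rightarrow> 'p) \<Rightarrow> ereal \<times> ereal" where
  "T_stat M P N l A x0 \<rho> h d =
     (enn2ereal (risk M P (alg_loss l A x0) h) - enn2ereal (emp_risk N (alg_loss l A x0) h d),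
      ereal ((\<rho> h)\<^sup>2 / real N) * enn2ereal (\<integral>\<^sup>+\<omega>. (l x0 (P \<omega>))\<^sup>2 \<partial>M))"

definition pairing :: "real \<times> real \<Rightarrow> ereal \<times> ereal \<Rightarrow> ereal" where
  "pairing a t = ereal (fst a) * fst t + ereal (snd a) * snd t"

definition exp_ext :: "ereal \<Rightarrow> ennreal" where
  "exp_ext x = (case x of ereal r \<Rightarrow> ennreal (exp r) | PInfty \<Rightarrow> \<infinity> | MInfty \<Rightarrow> 0)"

definition c_fun ::
  "'w measure \<Rightarrow> ('w \<Rightarrow> 'p) \<Rightarrow> ('w \<Rightarrow> 'h::topological_space) \<Rightarrow> nat \<Rightarrow> ('x \<Rightarrow> 'p \<Rightarrow> ennreal) \<Rightarrow>
   ('h \<Rightarrow> 'x \<Rightarrow> 'p \<Rightarrow> 'x) \<Rightarrow> 'x \<Rightarrow> ('h \<Rightarrow> real) \<Rightarrow> real \<Rightarrow> (nat \<Rightarrow> 'p) \<Rightarrow> ennreal" where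
  "c_fun M P H N l A x0 \<rho> \<gamma> d =
     (\<integral>\<^sup>+h. exp_ext (pairing (eta \<gamma>) (T_stat M P N l A x0 \<rho> h d)) \<partial>(distr M borel H))"

end

theory Submission
  imports Defs
begin

text \<open>
  For a fixed hyperparameter, Fubini reduces the claim to
  \<open>\<bbbE> exp (\<gamma> (R(h) - R\<^sub>D(h))) \<le> exp (\<gamma>\<^sup>2 / (2 N) \<cdot> \<bbbE> L(h,P)\<^sup>2)\<close>. Because the losses are nonnegative, only the
  left tail matters: \<open>exp (-y) \<le> 1 - y + y\<^sup>2/2\<close> for \<open>y \<ge> 0\<close> gives
  \<open>\<bbbE> exp (-Y) \<le> exp (- \<bbbE> Y + \<bbbE> Y\<^sup>2 / 2)\<close>, which tensorises over the i.i.d. sample with \<open>Y = \<gamma>/N \<cdot> L(h,P)\<close>.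
\<close>

text \<open>The product of \<open>1 - x + x\<^sup>2 / 2\<close> and
  \<open>1 + x + x\<^sup>2 / 2\<close> is at least 1, so the first factor dominates the reciprocal
  of the quadratic Taylor lower bound for \<open>exp x\<close>. The sign of \<open>x\<close>
  matters: the estimate fails for negative \<open>x\<close>.\<close>

lemma exp_minus_upper_Taylor_quadratic:
  fixes x :: real
  assumes "0 \<le> x"
  shows "exp (- x) \<le> 1 - x + x\<^sup>2 / 2"
proof -
  have pos: "0 < 1 + x + x\<^sup>2 / 2"
    using assms by (simp add: add_pos_nonneg)
  have "(1 - x + x\<^sup>2 / 2) * (1 + x + x\<^sup>2 / 2) = 1 + (x\<^sup>2)\<^sup>2 / 4"
    by (simp add: field_simps power2_eq_square)
  then have "1 \<le> (1 - x + x\<^sup>2 / 2) * (1 + x + x\<^sup>2 / 2)"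
    by simp
  then have "1 / (1 + x + x\<^sup>2 / 2) \<le> 1 - x + x\<^sup>2 / 2"
    using pos by (simp add: divide_le_eq)
  moreover have "exp (- x) \<le> 1 / (1 + x + x\<^sup>2 / 2)"
    using exp_lower_Taylor_quadratic[OF assms] pos
    by (simp add: exp_minus inverse_eq_divide frac_le)
  ultimately show ?thesis by linarith
qed

lemma exp_ext_simps [simp]:
  "exp_ext (ereal r) = ennreal (exp r)" "exp_ext (- \<infinity>) = 0"
  by (simp_all add: exp_ext_def flip: MInfty_eq_minfinity)

lemma measurable_exp_ext [measurable]: "exp_ext \<in> borel_measurable borel"
proof -
  have "exp_ext = (\<lambda>x. if x = \<infinity> then \<infinity> else if x = - \<infinity> then 0 else ennreal (exp (real_of_ereal x)))"
    by (auto simp: fun_eq_iff exp_ext_def split: ereal.splits)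
  also have "\<dots> \<in> borel_measurable borel"
    by measurable
  finally show ?thesis .
qed

text \<open>Extended form of the quadratic bound. The linear term stands on the left because
  subtraction in \<open>ennreal\<close> is truncated; at infinity both sides are infinite.\<close>

lemma exp_ext_minus_plus_le:
  "exp_ext (- enn2ereal y) + y \<le> 1 + ennreal (1 / 2) * y\<^sup>2"
proof (cases y)
  case (real r)
  have "ennreal (exp (- r) + r) \<le> ennreal (1 + 1 / 2 * r\<^sup>2)"
    using exp_minus_upper_Taylor_quadratic[OF real(1)] by (intro ennreal_leI) simp
  moreover have "1 + ennreal (1 / 2) * (ennreal r)\<^sup>2 = ennreal (1 + 1 / 2 * r\<^sup>2)"
    using real(1) by (simp add: ennreal_power ennreal_mult[symmetric] ennreal_plus del: ennreal_half)
  ultimately show ?thesis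
    using real by (simp add: ennreal_plus)
next
  case top
  then show ?thesis
    by (simp add: ennreal_mult_top)
qed

text \<open>The functional equation of exp survives infinite summands: such a summand contributes a
  factor 0, and the sum becomes infinite.\<close>

lemma prod_exp_ext_minus:
  assumes "finite I"
  shows "(\<Prod>i\<in>I. exp_ext (- enn2ereal (y i))) = exp_ext (- enn2ereal (\<Sum>i\<in>I. y i))"
  using assms
proof (induction I)
  case empty
  then show ?case
    using exp_ext_simps(1)[of 0] by (simp add: zero_ennreal.rep_eq flip: zero_ereal_def)
next
  case (insert j I)
  have "exp_ext (- enn2ereal a) * exp_ext (- enn2ereal b) = exp_ext (- enn2ereal (a + b))" for a b
    by (cases a; cases b)
      (simp_all add: ennreal_mult[symmetric] ennreal_plus[symmetric] mult_exp_exp del: ennreal_plus)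
  with insert show ?case by simp
qed

text \<open>Separates the deterministic factor from the one carrying the empirical risk
  \<open>e\<close>. A finite \<open>m\<close> rules out the difference of two infinities, and
  \<open>0 < \<gamma>\<close> makes both sides vanish when \<open>e\<close> is infinite.\<close>

lemma exp_ext_pairing_eta:
  assumes "0 < \<gamma>" "0 \<le> m"
  shows "exp_ext (pairing (eta \<gamma>) (ereal m - enn2ereal e, ereal v)) =
    ennreal (exp (\<gamma> * m - \<gamma>\<^sup>2 / 2 * v)) * exp_ext (- enn2ereal (ennreal \<gamma> * e))"
proof (cases e)
  case (real r)
  then have "ennreal \<gamma> * e = ennreal (\<gamma> * r)"
    using assms by (simp add: ennreal_mult)
  then show ?thesis
    using real assms
    by (simp add: pairing_def eta_def ennreal_mult[symmetric] mult_exp_exp algebra_simps)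
next
  case top
  then show ?thesis
    using assms by (simp add: pairing_def eta_def ennreal_mult_top)
qed

text \<open>Integrate the pointwise quadratic bound, then apply \<open>1 + u \<le> exp u\<close>.
  The integrated bound also controls the mean, so \<open>enn2real\<close> is only applied to finite
  values.\<close>

lemma (in prob_space) nn_integral_exp_ext_minus_le:
  assumes [measurable]: "Y \<in> borel_measurable M"
    and fin: "(\<integral>\<^sup>+x. (Y x)\<^sup>2 \<partial>M) < \<infinity>"
  shows "(\<integral>\<^sup>+x. exp_ext (- enn2ereal (Y x)) \<partial>M) \<le>
      ennreal (exp (- enn2real (\<integral>\<^sup>+x. Y x \<partial>M) + enn2real (\<integral>\<^sup>+x. (Y x)\<^sup>2 \<partial>M) / 2))"
    and "(\<integral>\<^sup>+x. Y x \<partial>M) < \<infinity>"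
proof -
  let ?E = "\<integral>\<^sup>+x. exp_ext (- enn2ereal (Y x)) \<partial>M"
  let ?m = "\<integral>\<^sup>+x. Y x \<partial>M" and ?s = "\<integral>\<^sup>+x. (Y x)\<^sup>2 \<partial>M"
  have "(\<integral>\<^sup>+x. exp_ext (- enn2ereal (Y x)) + Y x \<partial>M) \<le> (\<integral>\<^sup>+x. 1 + ennreal (1 / 2) * (Y x)\<^sup>2 \<partial>M)"
    by (intro nn_integral_mono exp_ext_minus_plus_le)
  then have "?E + ?m \<le> 1 + ennreal (1 / 2) * ?s"
    by (simp add: nn_integral_add nn_integral_cmult emeasure_space_1)
  moreover obtain s where s: "?s = ennreal s" "0 \<le> s"
    using fin by (cases ?s) auto
  moreover have "1 + ennreal (1 / 2) * ennreal s = ennreal (1 + 1 / 2 * s)"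
    using s by (subst ennreal_mult[symmetric]) (simp_all add: ennreal_plus)
  ultimately have le: "?E + ?m \<le> ennreal (1 + 1 / 2 * s)"
    by simp
  also have "\<dots> < \<infinity>"
    by simp
  \<comment> \<open>Both summands are finite, so the inequality can be moved to the reals, where the
    mean may be subtracted.\<close>
  finally have fin': "?E + ?m < \<infinity>" .
  then show fin_m: "?m < \<infinity>"
    by simp
  obtain e where e: "?E = ennreal e" "0 \<le> e"
    using fin' by (cases ?E) auto
  obtain m where m: "?m = ennreal m" "0 \<le> m"
    using fin_m by (cases ?m) auto
  have "ennreal (e + m) \<le> ennreal (1 + 1 / 2 * s)"
    using le e m by (simp add: ennreal_plus)
  then have "e + m \<le> 1 + 1 / 2 * s"
    using s by (subst (asm) ennreal_le_iff) auto
  then have "e \<le> 1 + (- m + s / 2)"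
    by simp
  also have "\<dots> \<le> exp (- m + s / 2)"
    by (rule exp_ge_add_one_self)
  finally show "?E \<le> ennreal (exp (- enn2real ?m + enn2real ?s / 2))"
    using e m s by (simp add: ennreal_leI)
qed

text \<open>Independence factors the expectation, and equality of laws reduces every factor to that
  of the reference index \<open>k\<close>. Since \<open>k\<close> may lie outside \<open>J\<close>,
  the moments of a fresh copy can control the sum over the sample.\<close>

lemma nn_integral_exp_ext_sum_le:
  assumes "prob_space M"
    and iid: "iid_vars M S X I" "finite I" "k \<in> I" "J \<subseteq> I"
    and Y [measurable]: "Y \<in> borel_measurable S"
    and fin: "(\<integral>\<^sup>+\<omega>. (Y (X k \<omega>))\<^sup>2 \<partial>M) < \<infinity>"
  shows "(\<integral>\<^sup>+\<omega>. exp_ext (- enn2ereal (\<Sum>i\<in>J. Y (X i \<omega>))) \<partial>M) \<le>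
    ennreal (exp (real (card J) * (- enn2real (\<integral>\<^sup>+\<omega>. Y (X k \<omega>) \<partial>M) +
      enn2real (\<integral>\<^sup>+\<omega>. (Y (X k \<omega>))\<^sup>2 \<partial>M) / 2)))"
proof -
  interpret prob_space M by fact
  have indep: "indep_vars (\<lambda>_. S) X J"
    using iid indep_vars_subset unfolding iid_vars_def by blast
  have X: "X i \<in> measurable M S" if "i \<in> I" for i
    using iid(1) that unfolding iid_vars_def indep_vars_def by blast
  note [measurable] = X[OF iid(3)]
  have eq: "(\<integral>\<^sup>+\<omega>. exp_ext (- enn2ereal (Y (X i \<omega>))) \<partial>M) = (\<integral>\<^sup>+\<omega>. exp_ext (- enn2ereal (Y (X k \<omega>))) \<partial>M)"
    if "i \<in> J" for i
  proof -
    have i: "i \<in> I"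
      using that iid by blast
    note [measurable] = X[OF i]
    have "distr M S (X i) = distr M S (X k)"
      using iid i unfolding iid_vars_def by blast
    then have "(\<integral>\<^sup>+x. exp_ext (- enn2ereal (Y x)) \<partial>distr M S (X i)) =
        (\<integral>\<^sup>+x. exp_ext (- enn2ereal (Y x)) \<partial>distr M S (X k))"
      by simp
    then show ?thesis
      by (simp add: nn_integral_distr)
  qed
  have J: "finite J"
    using iid finite_subset by blast
  have "(\<integral>\<^sup>+\<omega>. exp_ext (- enn2ereal (\<Sum>i\<in>J. Y (X i \<omega>))) \<partial>M) =
      (\<integral>\<^sup>+\<omega>. (\<Prod>i\<in>J. exp_ext (- enn2ereal (Y (X i \<omega>)))) \<partial>M)"
    by (simp add: prod_exp_ext_minus[OF J])
  also have "\<dots> = (\<Prod>i\<in>J. \<integral>\<^sup>+\<omega>. exp_ext (- enn2ereal (Y (X i \<omega>))) \<partial>M)"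
    by (intro indep_vars_nn_integral J indep_vars_compose2[OF indep]) simp_all
  also have "\<dots> = (\<integral>\<^sup>+\<omega>. exp_ext (- enn2ereal (Y (X k \<omega>))) \<partial>M) ^ card J"
    by (subst prod.cong[OF refl eq]) simp_all
  also have "\<dots> \<le> ennreal (exp (- enn2real (\<integral>\<^sup>+\<omega>. Y (X k \<omega>) \<partial>M) +
      enn2real (\<integral>\<^sup>+\<omega>. (Y (X k \<omega>))\<^sup>2 \<partial>M) / 2)) ^ card J"
    by (intro power_mono nn_integral_exp_ext_minus_le(1)[OF _ fin]) simp_all
  finally show ?thesis
    by (simp only: ennreal_power[OF exp_ge_zero] exp_of_nat_mult)
qed

text \<open>In the application \<open>Z = L(h, _)\<close> for a fixed \<open>h\<close>, and \<open>v = \<rho>(h)\<^sup>2 \<cdot> \<bbbE> \<ell>(x\<^sub>0, P)\<^sup>2\<close>.\<close>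

lemma nn_integral_exp_ext_pairing_le_1:
  assumes "prob_space M"
    and iid: "iid_vars M S X {0..N}" and N: "N \<ge> 1"
    and Z [measurable]: "Z \<in> borel_measurable S"
    and var: "(\<integral>\<^sup>+\<omega>. (Z (X 0 \<omega>))\<^sup>2 \<partial>M) \<le> ennreal v" "0 \<le> v"
    and \<gamma>: "0 < \<gamma>"
  shows "(\<integral>\<^sup>+\<omega>. exp_ext (pairing (eta \<gamma>)
    (enn2ereal (\<integral>\<^sup>+\<omega>'. Z (X 0 \<omega>') \<partial>M) - enn2ereal (ennreal (1 / real N) * (\<Sum>i=1..N. Z (X i \<omega>))),
      ereal (v / real N))) \<partial>M) \<le> 1"
proof -
  interpret prob_space M by fact
  have X: "X i \<in> measurable M S" if "i \<in> {0..N}" for i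
    using iid that unfolding iid_vars_def indep_vars_def by blast
  have [measurable]: "X 0 \<in> measurable M S"
    by (rule X) simp
  have [measurable]: "(\<lambda>\<omega>. \<Sum>i=1..N. c * Z (X i \<omega>)) \<in> borel_measurable M" for c
    using X Z by (intro borel_measurable_sum borel_measurable_times measurable_compose[OF _ Z]) simp_all
  \<comment> \<open>With this scale, \<open>\<gamma>\<close> times the empirical mean is the sum of
    the variables \<open>t * Z (X i)\<close>.\<close>
  define t where "t = \<gamma> / real N"
  have t: "0 < t" "\<gamma> = real N * t"
    using \<gamma> N by (simp_all add: t_def)
  have fin: "(\<integral>\<^sup>+\<omega>. (Z (X 0 \<omega>))\<^sup>2 \<partial>M) < \<infinity>"
    using var(1) by (rule le_less_trans) simp
  obtain s where s: "(\<integral>\<^sup>+\<omega>. (Z (X 0 \<omega>))\<^sup>2 \<partial>M) = ennreal s" "0 \<le> s"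
    using fin by (cases "\<integral>\<^sup>+\<omega>. (Z (X 0 \<omega>))\<^sup>2 \<partial>M") auto
  have sv: "s \<le> v"
    using var s by simp
  \<comment> \<open>A finite risk is what allows the statistic to be split by
    \<open>exp_ext_pairing_eta\<close>.\<close>
  have "(\<integral>\<^sup>+\<omega>. Z (X 0 \<omega>) \<partial>M) < \<infinity>"
    by (rule nn_integral_exp_ext_minus_le(2)[OF _ fin]) measurable
  then obtain m where m: "(\<integral>\<^sup>+\<omega>. Z (X 0 \<omega>) \<partial>M) = ennreal m" "0 \<le> m"
    by (cases "\<integral>\<^sup>+\<omega>. Z (X 0 \<omega>) \<partial>M") auto
  let ?Y = "\<lambda>x. ennreal t * Z x"
  have Y1: "(\<integral>\<^sup>+\<omega>. ?Y (X 0 \<omega>) \<partial>M) = ennreal (t * m)"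
    using t m by (simp add: nn_integral_cmult ennreal_mult)
  have Y2: "(\<integral>\<^sup>+\<omega>. (?Y (X 0 \<omega>))\<^sup>2 \<partial>M) = ennreal (t\<^sup>2 * s)"
    using t s by (simp add: power_mult_distrib nn_integral_cmult ennreal_mult ennreal_power)
  have scale: "ennreal \<gamma> * (ennreal (1 / real N) * e) = ennreal t * e" for e
    using t N by (simp add: mult.assoc[symmetric] ennreal_mult[symmetric])
  have "(\<integral>\<^sup>+\<omega>. exp_ext (pairing (eta \<gamma>)
      (enn2ereal (\<integral>\<^sup>+\<omega>'. Z (X 0 \<omega>') \<partial>M) - enn2ereal (ennreal (1 / real N) * (\<Sum>i=1..N. Z (X i \<omega>))),
        ereal (v / real N))) \<partial>M) =
      (\<integral>\<^sup>+\<omega>. ennreal (exp (\<gamma> * m - \<gamma>\<^sup>2 / 2 * (v / real N))) *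
        exp_ext (- enn2ereal (\<Sum>i=1..N. ?Y (X i \<omega>))) \<partial>M)"
    using m \<gamma> by (simp add: exp_ext_pairing_eta scale sum_distrib_left)
  also have "\<dots> = ennreal (exp (\<gamma> * m - \<gamma>\<^sup>2 / 2 * (v / real N))) *
      (\<integral>\<^sup>+\<omega>. exp_ext (- enn2ereal (\<Sum>i=1..N. ?Y (X i \<omega>))) \<partial>M)"
    by (rule nn_integral_cmult) measurable
  also have "\<dots> \<le> ennreal (exp (\<gamma> * m - \<gamma>\<^sup>2 / 2 * (v / real N))) *
      ennreal (exp (real N * (- (t * m) + t\<^sup>2 * s / 2)))"
  proof (rule mult_left_mono)
    show "(\<integral>\<^sup>+\<omega>. exp_ext (- enn2ereal (\<Sum>i=1..N. ?Y (X i \<omega>))) \<partial>M) \<le>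
        ennreal (exp (real N * (- (t * m) + t\<^sup>2 * s / 2)))"
      using nn_integral_exp_ext_sum_le[OF \<open>prob_space M\<close> iid, of 0 "{1..N}" ?Y] t m s
      by (simp add: Y1 Y2)
  qed simp
  \<comment> \<open>The means cancel because \<open>\<gamma> = real N * t\<close>; only the true
    second moment \<open>s\<close> against its bound \<open>v\<close> remains.\<close>
  also have "\<dots> = ennreal (exp (real N * t\<^sup>2 / 2 * (s - v)))"
    using N by (simp add: ennreal_mult[symmetric] mult_exp_exp t(2) field_simps power2_eq_square)
  also have "\<dots> \<le> 1"
    using sv by (simp add: mult_nonneg_nonpos)
  finally show ?thesis .
qed

theorem mainTheorem4:
  fixes M :: "'w measure"
    and l :: "real ^ 'n \<Rightarrow> 'p::polish_space \<Rightarrow> ennreal"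
    and A :: "'h::polish_space \<Rightarrow> real ^ 'n \<Rightarrow> 'p \<Rightarrow> real ^ 'n"
    and x0 :: "real ^ 'n"
    and N :: nat
    and P :: "'w \<Rightarrow> 'p" and Ps :: "nat \<Rightarrow> 'w \<Rightarrow> 'p"
    and H :: "'w \<Rightarrow> 'h"
    and \<rho> :: "'h \<Rightarrow> real"
  assumes "prob_space M"
    and "N \<ge> 1"
    and "(\<lambda>(x, p). l x p) \<in> borel_measurable (borel \<Otimes>\<^sub>M borel)"
    and "(\<lambda>(h, x, p). A h x p) \<in> borel_measurable (borel \<Otimes>\<^sub>M borel \<Otimes>\<^sub>M borel)"
    and "iid_vars M borel (Ps(0 := P)) {0..N}"
    and "H \<in> borel_measurable M"
    and "indep_rv M borel H (data_space N) (data_var N Ps)"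
    and "indep_rv M borel H borel P"
    and "\<rho> \<in> borel_measurable borel"
    and "\<And>h. 0 \<le> \<rho> h"
    and "\<And>h. AE p in distr M borel P. l (A h x0 p) p \<le> ennreal (\<rho> h) * l x0 p"
    and "(\<integral>\<^sup>+\<omega>. (l x0 (P \<omega>))\<^sup>2 \<partial>M) < \<infinity>"
  shows "\<forall>\<gamma>>0. (\<integral>\<^sup>+\<omega>. c_fun M P H N l A x0 \<rho> \<gamma> (data_var N Ps \<omega>) \<partial>M) \<le> 1"
proof (intro allI impI)
  fix \<gamma> :: real
  assume \<gamma>: "0 < \<gamma>"
  interpret prob_space M by fact
  define L where "L = alg_loss l A x0"
  define D where "D = distr M (data_space N) (data_var N Ps)"
  define g where "g h d = exp_ext (pairing (eta \<gamma>) (T_stat M P N l A x0 \<rho> h d))" for h d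
  note [measurable] = assms(3,4,6,9)
  have D [measurable]: "data_var N Ps \<in> measurable M (data_space N)"
    using assms(7) by (simp add: indep_rv_def)
  have P [measurable]: "P \<in> borel_measurable M"
    using assms(8) by (simp add: indep_rv_def)
  \<comment> \<open>Joint measurability of the uncurried maps is turned into composition rules for
    the curried ones.\<close>
  have l_comp: "(\<lambda>z. l (f z) (q z)) \<in> borel_measurable K"
    if "f \<in> borel_measurable K" "q \<in> borel_measurable K" for f q and K :: "'z measure"
    using measurable_compose[OF measurable_Pair[OF that] assms(3)] by simp
  have A_comp: "(\<lambda>z. A (k z) x0 (q z)) \<in> borel_measurable K"
    if "k \<in> borel_measurable K" "q \<in> borel_measurable K" for k q and K :: "'z measure"
    using measurable_compose[OF measurable_Pair[OF that(1) measurable_Pair[OF measurable_const that(2)]] assms(4)]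
    by simp
  have L_comp [measurable]: "(\<lambda>z. L (k z) (q z)) \<in> borel_measurable K"
    if "k \<in> borel_measurable K" "q \<in> borel_measurable K" for k q and K :: "'z measure"
    unfolding L_def alg_loss_def using that by (intro l_comp A_comp)
  have l0 [measurable]: "l x0 \<in> borel_measurable borel"
    by (rule l_comp) simp_all
  obtain s where s: "(\<integral>\<^sup>+\<omega>. (l x0 (P \<omega>))\<^sup>2 \<partial>M) = ennreal s" "0 \<le> s"
    using assms(12) by (cases "\<integral>\<^sup>+\<omega>. (l x0 (P \<omega>))\<^sup>2 \<partial>M") auto
  \<comment> \<open>This brings the integrand into the shape of
    \<open>nn_integral_exp_ext_pairing_le_1\<close> with \<open>Z = L h\<close> and
    \<open>v = (\<rho> h)\<^sup>2 * s\<close>.\<close>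
  have g_eq: "g h d = exp_ext (pairing (eta \<gamma>)
      (enn2ereal (\<integral>\<^sup>+\<omega>. L h (P \<omega>) \<partial>M) - enn2ereal (ennreal (1 / real N) * (\<Sum>i=1..N. L h (d i))),
        ereal ((\<rho> h)\<^sup>2 * s / real N)))" for h d
    using s by (simp add: g_def T_stat_def risk_def emp_risk_def L_def)
  have g [measurable]: "(\<lambda>(h, d). g h d) \<in> borel_measurable (borel \<Otimes>\<^sub>M data_space N)"
  proof -
    have [measurable]: "(\<lambda>z. \<Sum>i=1..N. L (fst z) (snd z i)) \<in> borel_measurable (borel \<Otimes>\<^sub>M data_space N)"
      by (intro borel_measurable_sum L_comp measurable_compose[OF measurable_snd measurable_component_singleton])
        simp_all
    \<comment> \<open>The risk is an integral with parameter \<open>h\<close>, hence measurable in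
      \<open>h\<close> by joint measurability of the loss.\<close>
    have [measurable]: "(\<lambda>h. \<integral>\<^sup>+\<omega>. L h (P \<omega>) \<partial>M) \<in> borel_measurable borel"
      by (intro borel_measurable_nn_integral) (simp add: split_beta' L_comp)
    show ?thesis
      unfolding g_eq split_beta' pairing_def fst_conv snd_conv by measurable
  qed
  have le_1: "(\<integral>\<^sup>+d. g h d \<partial>D) \<le> 1" for h
  proof -
    have [measurable]: "L h \<in> borel_measurable borel"
      by (rule L_comp) simp_all
    have "AE \<omega> in M. L h (P \<omega>) \<le> ennreal (\<rho> h) * l x0 (P \<omega>)"
      using AE_distrD[OF P assms(11)[of h]] by (simp add: L_def alg_loss_def)
    then have "(\<integral>\<^sup>+\<omega>. (L h (P \<omega>))\<^sup>2 \<partial>M) \<le> (\<integral>\<^sup>+\<omega>. (ennreal (\<rho> h))\<^sup>2 * (l x0 (P \<omega>))\<^sup>2 \<partial>M)"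
      by (intro nn_integral_mono_AE) (auto elim!: eventually_mono simp: power_mult_distrib[symmetric] intro: power_mono)
    also have "\<dots> = ennreal ((\<rho> h)\<^sup>2 * s)"
      using s assms(10)[of h] by (simp add: nn_integral_cmult ennreal_power ennreal_mult)
    \<comment> \<open>Index 0 of the i.i.d. family holds the fresh copy \<open>P\<close>; on
      \<open>{1..N}\<close> the family agrees with the sample \<open>Ps\<close>.\<close>
    finally have var: "(\<integral>\<^sup>+\<omega>. (L h ((Ps(0 := P)) 0 \<omega>))\<^sup>2 \<partial>M) \<le> ennreal ((\<rho> h)\<^sup>2 * s)"
      by simp
    have "(\<integral>\<^sup>+d. g h d \<partial>D) = (\<integral>\<^sup>+\<omega>. g h (data_var N Ps \<omega>) \<partial>M)"
      unfolding D_def by (intro nn_integral_distr D) measurable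
    also have "\<dots> \<le> 1"
      using nn_integral_exp_ext_pairing_le_1[OF assms(1,5,2) \<open>L h \<in> borel_measurable borel\<close> var _ \<gamma>] s(2)
      by (simp add: g_eq data_var_def)
    finally show ?thesis .
  qed
  interpret HM: prob_space "distr M borel H"
    by (rule prob_space_distr) measurable
  interpret DM: prob_space D
    unfolding D_def by (rule prob_space_distr) measurable
  interpret pair_sigma_finite "distr M borel H" D ..
  have "(\<integral>\<^sup>+\<omega>. c_fun M P H N l A x0 \<rho> \<gamma> (data_var N Ps \<omega>) \<partial>M) =
      (\<integral>\<^sup>+\<omega>. (\<integral>\<^sup>+h. g h (data_var N Ps \<omega>) \<partial>distr M borel H) \<partial>M)"
    by (simp add: c_fun_def g_def)
  also have "\<dots> = (\<integral>\<^sup>+d. (\<integral>\<^sup>+h. g h d \<partial>distr M borel H) \<partial>D)"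
    unfolding D_def by (intro nn_integral_distr[symmetric] D) measurable
  \<comment> \<open>After the exchange, the inner integral has a fixed \<open>h\<close> and is
    bounded by \<open>le_1\<close>.\<close>
  also have "\<dots> = (\<integral>\<^sup>+h. (\<integral>\<^sup>+d. g h d \<partial>D) \<partial>distr M borel H)"
    by (rule Fubini') (unfold D_def, measurable)
  also have "\<dots> \<le> (\<integral>\<^sup>+h. 1 \<partial>distr M borel H)"
    by (intro nn_integral_mono le_1)
  also have "\<dots> = 1"
    using HM.emeasure_space_1 by simp
  finally show "(\<integral>\<^sup>+\<omega>. c_fun M P H N l A x0 \<rho> \<gamma> (data_var N Ps \<omega>) \<partial>M) \<le> 1" .
qed

end
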